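(* 1. Let $X$ be a proper Busemann space. Then for every horofunction $\Phi$ on $X$ and every $y\in X$, $$\overline{\mathcal{HB}(\Phi,y)}_g=\mathcal{HB}(\Phi,y)\cup\mathcal{HB}_\infty(\Phi).$$ 2. Let $X$ be a geodesically complete proper Busemann space. Then for every horofunction $\Phi$ on $X$ and every $y\in X$, $$\mathcal{HS}_\infty(\Phi)\subset\overline{\mathcal{HS}(\Phi,y)}_g\setminus\mathcal{HS}(\Phi,y).$$
   Context: Busemann space: a geodesic metric space $X$ (distance written $|xy|$) such that for any two geodesic segments with affine parameterizations $\gamma:[a,b]\to X$, $\gamma':[a',b']\to X$ the function $(t,t')\mapsto|\gamma(t)\gamma'(t')|$ is convex. Proper means closed balls are compact. Geodesically complete means every nondegenerate geodesic segment extends to a complete geodesic $\mathbb{R}\to X$. A ray is a distance-preserving map $c:\mathbb{R}_+=[0,\infty)\to X$. Two rays are asymptotic if the Hausdorff distance between their images is finite; $\partial_gX$ (geodesic boundary) is the set of asymptoticity classes of rays, and $c(+\infty)$ denotes the class of $c$. For each $x\in X$, $\xi\in\partial_gX$ there is a unique ray $[x\xi]$ starting at $x$ in the class $\xi$. Geodesic compactification $\overline{X}_g=X\cup\partial_gX$ with the cone topology: fixing $o\in X$, a sequence $x_i\in\overline{X}_g$ converges to $x\in\overline{X}_g$ iff $|ox_i|\to|ox|$ (with $|ox|=\infty$ for $x\in\partial_gX$) and the naturally parameterized segments/rays $[ox_i]$ converge to $[ox]$ (uniformly on bounded sets). It is compact and independent of $o$. For $A\subset X$, $\overline{A}_g$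 denotes the closure of $A$ in $\overline{X}_g$. Horofunctions: let $C(X,\mathbb{R})$ be the continuous functions with the topology of uniform convergence on bounded sets and $C^*(X,\mathbb{R})=C(X,\mathbb{R})/\{\text{constants}\}$; embed $X$ into $C^*(X,\mathbb{R})$ by $x\mapsto$ class of $y\mapsto|xy|$; $\overline{X}_h$ is the closure of the image and $\partial_hX=\overline{X}_h\setminus X$. A horofunction is a function $\Phi:X\to\mathbb{R}$ whose class $[\Phi]$ modulo constants lies in $\partial_hX$. Horoball: $\mathcal{HB}(\Phi,y)=\{x\in X:\Phi(x)\le\Phi(y)\}$; horosphere: $\mathcal{HS}(\Phi,y)=\{x\in X:\Phi(x)=\Phi(y)\}$. A function $f:\mathbb{R}_+\to\mathbb{R}$ decreases sublinearly if there are $k<0$, $b\in\mathbb{R}$ with $f(t)\le kt+b$ for all $t\ge0$. Relations (the symbol $\operatorname{Td}$ is not a metric) for $[\Phi]\in\partial_hX$, $\xi\in\partial_gX$: $\operatorname{Td}([\Phi],\xi)\le\pi/2$ if $\Phi\circ c$ is non-increasing for some (equivalently, every) ray $c$ with $c(+\infty)=\xi$; $\operatorname{Td}([\Phi],\xi)<\pi/2$ if $\Phi\circ c$ decreases sublinearly for every ray $c$ with $c(+\infty)=\xi$; $\operatorname{Td}([\Phi],\xi)\ge\pi/2$ if not $\operatorname{Td}([\Phi],\xi)<\pi/2$; $\operatorname{Td}([\Phi],\xi)=\pi/2$ if both $\operatorname{Td}([\Phi],\xi)\le\pi/2$ and $\operatorname{Td}([\Phi],\xi)\ge\pi/2$.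 Horoball and horosphere at infinity: $\mathcal{HB}_\infty(\Phi)=\{\xi\in\partial_gX:\operatorname{Td}([\Phi],\xi)\le\pi/2\}$, $\mathcal{HS}_\infty(\Phi)=\{\xi\in\partial_gX:\operatorname{Td}([\Phi],\xi)=\pi/2\}$. *)

theory Defs
  imports "HOL-Analysis.Analysis"
begin

section \<open>Busemann spaces\<close>

text \<open>
  The metric space $X$ is the whole type \<open>'a\<close>. Maps defined on an interval or on
  $[0,\infty)$ are total functions on \<^typ>\<open>real\<close> whose values outside that set are irrelevant.
\<close>

definition geodesic_on :: "real set \<Rightarrow> (real \<Rightarrow> 'a::metric_space) \<Rightarrow> bool" where
  "geodesic_on S c \<longleftrightarrow> (\<forall>s\<in>S. \<forall>t\<in>S. dist (c s) (c t) = \<bar>s - t\<bar>)"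

definition geodesic_space :: "'a::metric_space itself \<Rightarrow> bool" where
  "geodesic_space _ \<longleftrightarrow>
     (\<forall>x y::'a. \<exists>c. geodesic_on {0..dist x y} c \<and> c 0 = x \<and> c (dist x y) = y)"

definition affine_segment :: "real \<Rightarrow> real \<Rightarrow> (real \<Rightarrow> 'a::metric_space) \<Rightarrow> bool" where
  "affine_segment a b c \<longleftrightarrow>
     a \<le> b \<and> (\<exists>v\<ge>0. \<forall>s\<in>{a..b}. \<forall>t\<in>{a..b}. dist (c s) (c t) = v * \<bar>s - t\<bar>)"

definition busemann_space :: "'a::metric_space itself \<Rightarrow> bool" where
  "busemann_space T \<longleftrightarrow> geodesic_space T \<and>
     (\<forall>a b a' b' (c :: real \<Rightarrow> 'a) c'.
        affine_segment a b c \<longrightarrow> affine_segment a' b' c' \<longrightarrow>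
        convex_on ({a..b} \<times> {a'..b'}) (\<lambda>(t, t'). dist (c t) (c' t')))"

definition proper_space :: "'a::metric_space itself \<Rightarrow> bool" where
  "proper_space _ \<longleftrightarrow> (\<forall>(x::'a) r. compact (cball x r))"

definition geodesically_complete :: "'a::metric_space itself \<Rightarrow> bool" where
  "geodesically_complete _ \<longleftrightarrow>
     (\<forall>a b (c :: real \<Rightarrow> 'a). a < b \<longrightarrow> geodesic_on {a..b} c \<longrightarrow>
        (\<exists>l. geodesic_on UNIV l \<and> (\<forall>t\<in>{a..b}. l t = c t)))"


section \<open>The geodesic boundary\<close>

definition ray :: "(real \<Rightarrow> 'a::metric_space) \<Rightarrow> bool" where
  "ray c \<longleftrightarrow> geodesic_on {0..} c"

definition hausdorff_dist :: "'a::metric_space set \<Rightarrow> 'a set \<Rightarrow> ereal" where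
  "hausdorff_dist A B =
     max (SUP a\<in>A. INF b\<in>B. ereal (dist a b)) (SUP b\<in>B. INF a\<in>A. ereal (dist a b))"

definition asymptotic :: "((real \<Rightarrow> 'a::metric_space) \<times> (real \<Rightarrow> 'a)) set" where
  "asymptotic =
     {(c, c'). ray c \<and> ray c' \<and> hausdorff_dist (c ` {0..}) (c' ` {0..}) < \<infinity>}"

text \<open>The class $c(+\infty)$ of a ray.\<close>

definition endpoint :: "(real \<Rightarrow> 'a::metric_space) \<Rightarrow> (real \<Rightarrow> 'a) set" where
  "endpoint c = asymptotic `` {c}"

definition geo_boundary :: "(real \<Rightarrow> 'a::metric_space) set set" where
  "geo_boundary = {c. ray c} // asymptotic"


section \<open>The geodesic compactification\<close>

type_synonym 'a geo_point = "'a + (real \<Rightarrow> 'a) set"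

definition geo_compactification :: "'a::metric_space geo_point set" where
  "geo_compactification = range Inl \<union> Inr ` geo_boundary"

fun geo_dist :: "'a::metric_space \<Rightarrow> 'a geo_point \<Rightarrow> ereal" where
  "geo_dist p (Inl x) = ereal (dist p x)"
| "geo_dist p (Inr \<xi>) = \<infinity>"

text \<open>
  The natural parameterization of $[px]$ or $[p\xi]$ on $[0,\infty)$. A segment is continued
  by its endpoint, so that parameterizations of different lengths can be compared. In a Busemann
  space the choice is unique on the relevant interval.
\<close>

fun geo_path :: "'a::metric_space \<Rightarrow> 'a geo_point \<Rightarrow> real \<Rightarrow> 'a" where
  "geo_path p (Inl x) t =
     (SOME c. geodesic_on {0..dist p x} c \<and> c 0 = p \<and> c (dist p x) = x) (min t (dist p x))"
| "geo_path p (Inr \<xi>) t = (SOME c. ray c \<and> c 0 = p \<and> endpoint c = \<xi>) t"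

definition cone_converges ::
    "'a::metric_space \<Rightarrow> (nat \<Rightarrow> 'a geo_point) \<Rightarrow> 'a geo_point \<Rightarrow> bool" where
  "cone_converges p x l \<longleftrightarrow>
     (\<lambda>i. geo_dist p (x i)) \<longlonglongrightarrow> geo_dist p l \<and>
     (\<forall>B\<subseteq>{0..}. bounded B \<longrightarrow>
        uniform_limit B (\<lambda>i. geo_path p (x i)) (geo_path p l) sequentially)"

text \<open>
  The cone topology with base point \<open>p\<close> is described by its convergent sequences:
  a set is open iff it is sequentially open. The lemma \<open>limitin_cone_topology\<close> below
  shows that the convergent sequences of this topology are exactly the prescribed ones.
\<close>

definition cone_topology :: "'a::metric_space \<Rightarrow> 'a geo_point topology" where
  "cone_topology p = topology (\<lambda>U. U \<subseteq> geo_compactification \<and>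
     (\<forall>x l. (\<forall>i. x i \<in> geo_compactification) \<longrightarrow> l \<in> U \<longrightarrow> cone_converges p x l \<longrightarrow>
        (\<forall>\<^sub>F i in sequentially. x i \<in> U)))"

lemma openin_cone_topology:
  "openin (cone_topology p) U \<longleftrightarrow> U \<subseteq> geo_compactification \<and>
     (\<forall>x l. (\<forall>i. x i \<in> geo_compactification) \<longrightarrow> l \<in> U \<longrightarrow> cone_converges p x l \<longrightarrow>
        (\<forall>\<^sub>F i in sequentially. x i \<in> U))"
proof -
  have "istopology (\<lambda>U. U \<subseteq> geo_compactification \<and>
     (\<forall>x l. (\<forall>i. x i \<in> geo_compactification) \<longrightarrow> l \<in> U \<longrightarrow> cone_converges p x l \<longrightarrow>
        (\<forall>\<^sub>F i in sequentially. x i \<in> U)))" (is "istopology ?L")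
    unfolding istopology_def
  proof (intro conjI allI impI)
    fix S T assume "?L S" "?L T"
    then show "S \<inter> T \<subseteq> geo_compactification" by blast
  next
    fix S T x l
    assume "?L S" "?L T" "\<forall>i. x i \<in> geo_compactification" "l \<in> S \<inter> T" "cone_converges p x l"
    then have "\<forall>\<^sub>F i in sequentially. x i \<in> S" "\<forall>\<^sub>F i in sequentially. x i \<in> T" by blast+
    then show "\<forall>\<^sub>F i in sequentially. x i \<in> S \<inter> T" by eventually_elim blast
  next
    fix \<K> assume "\<forall>K\<in>\<K>. ?L K"
    then show "\<Union>\<K> \<subseteq> geo_compactification" by blast
  next
    fix \<K> x l
    assume *: "\<forall>K\<in>\<K>. ?L K" "\<forall>i. x i \<in> geo_compactification" "l \<in> \<Union>\<K>" "cone_converges p x l"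
    then obtain K where K: "K \<in> \<K>" "l \<in> K" by blast
    with * have "\<forall>\<^sub>F i in sequentially. x i \<in> K" by blast
    then show "\<forall>\<^sub>F i in sequentially. x i \<in> \<Union>\<K>" by eventually_elim (use K in blast)
  qed
  then show ?thesis by (simp add: cone_topology_def)
qed

lemma topspace_cone_topology [simp]: "topspace (cone_topology p) = geo_compactification"
proof -
  have "openin (cone_topology p) geo_compactification"
    by (auto simp: openin_cone_topology)
  then have "geo_compactification \<subseteq> topspace (cone_topology p)"
    by (rule openin_subset)
  moreover have "topspace (cone_topology p) \<subseteq> geo_compactification"
    using openin_topspace[of "cone_topology p"] unfolding openin_cone_topology by (rule conjunct1)
  ultimately show ?thesis by (rule subset_antisym[rotated])
qed

lemma limitin_cone_topology:
  assumes x: "\<forall>i. x i \<in> geo_compactification" and l: "l \<in> geo_compactification"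
  shows "limitin (cone_topology p) x l sequentially \<longleftrightarrow> cone_converges p x l"
proof
  assume "cone_converges p x l"
  with assms show "limitin (cone_topology p) x l sequentially"
    unfolding limitin_def topspace_cone_topology openin_cone_topology by blast
next
  assume lim: "limitin (cone_topology p) x l sequentially"
  have "(\<lambda>i. geo_dist p (x i)) \<longlonglongrightarrow> geo_dist p l"
  proof (rule topological_tendstoI)
    fix V assume V: "open V" "geo_dist p l \<in> V"
    have "openin (cone_topology p) {q \<in> geo_compactification. geo_dist p q \<in> V}"
      unfolding openin_cone_topology
    proof (intro conjI allI impI)
      fix y m assume y: "\<forall>i. y i \<in> geo_compactification"
        and "m \<in> {q \<in> geo_compactification. geo_dist p q \<in> V}" "cone_converges p y m"
      then have "\<forall>\<^sub>F i in sequentially. geo_dist p (y i) \<in> V"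
        using V(1) unfolding cone_converges_def by (auto dest: topological_tendstoD)
      then show "\<forall>\<^sub>F i in sequentially. y i \<in> {q \<in> geo_compactification. geo_dist p q \<in> V}"
        by eventually_elim (use y in auto)
    qed auto
    with lim V l have "\<forall>\<^sub>F i in sequentially. x i \<in> {q \<in> geo_compactification. geo_dist p q \<in> V}"
      unfolding limitin_def by blast
    then show "\<forall>\<^sub>F i in sequentially. geo_dist p (x i) \<in> V"
      by eventually_elim simp
  qed
  moreover have "uniform_limit B (\<lambda>i. geo_path p (x i)) (geo_path p l) sequentially"
    if B: "B \<subseteq> {0..}" "bounded B" for B
    unfolding uniform_limit_iff
  proof (intro allI impI)
    fix e :: real assume e: "e > 0"
    define U where "U = {q \<in> geo_compactification.
        \<exists>d<e. \<forall>t\<in>B. dist (geo_path p q t) (geo_path p l t) \<le> d}"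
    have "openin (cone_topology p) U"
      unfolding openin_cone_topology
    proof (intro conjI allI impI)
      fix y m assume y: "\<forall>i. y i \<in> geo_compactification" and "m \<in> U"
        and conv: "cone_converges p y m"
      then obtain d where d: "d < e" "\<And>t. t \<in> B \<Longrightarrow> dist (geo_path p m t) (geo_path p l t) \<le> d"
        unfolding U_def by blast
      have "\<forall>\<^sub>F i in sequentially. \<forall>t\<in>B. dist (geo_path p (y i) t) (geo_path p m t) < (e - d) / 2"
      proof -
        have "uniform_limit B (\<lambda>i. geo_path p (y i)) (geo_path p m) sequentially"
          using conv B unfolding cone_converges_def by blast
        then show ?thesis using d(1) by (auto dest!: uniform_limitD[where e = "(e - d) / 2"])
      qed
      then show "\<forall>\<^sub>F i in sequentially. y i \<in> U"
      proof eventually_elim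
        case (elim i)
        have "dist (geo_path p (y i) t) (geo_path p l t) \<le> (e + d) / 2" if "t \<in> B" for t
          using bspec[OF elim that] d(2)[OF that]
            dist_triangle[of "geo_path p (y i) t" "geo_path p l t" "geo_path p m t"]
          by (simp add: field_simps)
        moreover have "(e + d) / 2 < e" using d(1) by simp
        ultimately show ?case using y unfolding U_def by blast
      qed
    qed (auto simp: U_def)
    moreover have "l \<in> U" using l e unfolding U_def by (auto intro!: exI[of _ "0::real"])
    ultimately have "\<forall>\<^sub>F i in sequentially. x i \<in> U"
      using lim unfolding limitin_def by blast
    then show "\<forall>\<^sub>F i in sequentially. \<forall>t\<in>B. dist (geo_path p (x i) t) (geo_path p l t) < e"
      by eventually_elim (auto simp: U_def intro: le_less_trans)
  qed
  ultimately show "cone_converges p x l" by (simp add: cone_converges_def)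
qed


section \<open>Horofunctions\<close>

definition cont_fun :: "('a::metric_space \<Rightarrow> real) set" where
  "cont_fun = {f. continuous_on UNIV f}"

text \<open>The topology of uniform convergence on bounded sets.\<close>

definition ucb_topology :: "('a::metric_space \<Rightarrow> real) topology" where
  "ucb_topology = topology (\<lambda>U. U \<subseteq> cont_fun \<and>
     (\<forall>f\<in>U. \<exists>B e. bounded B \<and> e > 0 \<and> {g \<in> cont_fun. \<forall>x\<in>B. \<bar>g x - f x\<bar> < e} \<subseteq> U))"

lemma openin_ucb_topology:
  "openin ucb_topology U \<longleftrightarrow> U \<subseteq> cont_fun \<and>
     (\<forall>f\<in>U. \<exists>B e. bounded B \<and> e > 0 \<and> {g \<in> cont_fun. \<forall>x\<in>B. \<bar>g x - f x\<bar> < e} \<subseteq> U)"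
proof -
  have "istopology (\<lambda>U::('a \<Rightarrow> real) set. U \<subseteq> cont_fun \<and>
     (\<forall>f\<in>U. \<exists>B e. bounded B \<and> e > 0 \<and> {g \<in> cont_fun. \<forall>x\<in>B. \<bar>g x - f x\<bar> < e} \<subseteq> U))"
    (is "istopology ?L")
    unfolding istopology_def
  proof (intro conjI allI impI ballI)
    fix S T :: "('a \<Rightarrow> real) set" assume "?L S" "?L T"
    then show "S \<inter> T \<subseteq> cont_fun" by blast
  next
    fix S T :: "('a \<Rightarrow> real) set" and f assume S: "?L S" and T: "?L T" and f: "f \<in> S \<inter> T"
    obtain B e where
      1: "bounded B" "e > 0" "{g \<in> cont_fun. \<forall>x\<in>B. \<bar>g x - f x\<bar> < e} \<subseteq> S"
      using bspec[OF conjunct2[OF S] IntD1[OF f]] by (elim exE conjE)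
    obtain C d where
      2: "bounded C" "d > 0" "{g \<in> cont_fun. \<forall>x\<in>C. \<bar>g x - f x\<bar> < d} \<subseteq> T"
      using bspec[OF conjunct2[OF T] IntD2[OF f]] by (elim exE conjE)
    have "bounded (B \<union> C)" "min e d > 0" using 1(1,2) 2(1,2) by simp_all
    moreover have "{g \<in> cont_fun. \<forall>x\<in>B \<union> C. \<bar>g x - f x\<bar> < min e d} \<subseteq> S \<inter> T"
      by (intro subsetI IntI subsetD[OF 1(3)] subsetD[OF 2(3)]) simp_all
    ultimately show "\<exists>B e. bounded B \<and> e > 0 \<and>
        {g \<in> cont_fun. \<forall>x\<in>B. \<bar>g x - f x\<bar> < e} \<subseteq> S \<inter> T"
      by (intro exI conjI)
  next
    fix \<K> :: "('a \<Rightarrow> real) set set" assume "\<forall>K\<in>\<K>. ?L K"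
    then show "\<Union>\<K> \<subseteq> cont_fun" by blast
  next
    fix \<K> :: "('a \<Rightarrow> real) set set" and f assume K: "\<forall>K\<in>\<K>. ?L K" and "f \<in> \<Union>\<K>"
    then obtain K where "K \<in> \<K>" "f \<in> K" by (elim UnionE)
    obtain B e where 1: "bounded B" "e > 0"
      "{g \<in> cont_fun. \<forall>x\<in>B. \<bar>g x - f x\<bar> < e} \<subseteq> K"
      using bspec[OF conjunct2[OF bspec[OF K \<open>K \<in> \<K>\<close>]] \<open>f \<in> K\<close>] by (elim exE conjE)
    then show "\<exists>B e. bounded B \<and> e > 0 \<and>
        {g \<in> cont_fun. \<forall>x\<in>B. \<bar>g x - f x\<bar> < e} \<subseteq> \<Union>\<K>"
      by (intro exI conjI) (assumption, assumption, rule subset_trans[OF _ Union_upper[OF \<open>K \<in> \<K>\<close>]])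
  qed
  then show ?thesis by (simp add: ucb_topology_def)
qed

lemma topspace_ucb_topology [simp]: "topspace ucb_topology = cont_fun"
proof -
  have "openin ucb_topology (cont_fun :: ('a::metric_space \<Rightarrow> real) set)"
    unfolding openin_ucb_topology
    by (intro conjI ballI subset_refl exI[of _ "{}"] exI[of _ "1::real"]) auto
  then have "cont_fun \<subseteq> topspace (ucb_topology :: ('a \<Rightarrow> real) topology)"
    by (rule openin_subset)
  moreover have "topspace ucb_topology \<subseteq> (cont_fun :: ('a \<Rightarrow> real) set)"
    using openin_topspace[of "ucb_topology :: ('a \<Rightarrow> real) topology"]
    unfolding openin_ucb_topology by (rule conjunct1)
  ultimately show ?thesis by (rule subset_antisym[rotated])
qed

definition const_rel :: "(('a::metric_space \<Rightarrow> real) \<times> ('a \<Rightarrow> real)) set" where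
  "const_rel = {(f, g). f \<in> cont_fun \<and> g \<in> cont_fun \<and> (\<exists>k. \<forall>x. g x = f x + k)}"

definition fun_class :: "('a::metric_space \<Rightarrow> real) \<Rightarrow> ('a \<Rightarrow> real) set" where
  "fun_class f = const_rel `` {f}"

text \<open>The set $C^*(X,\mathbb{R})$ with the quotient topology.\<close>

definition Cstar_topology :: "('a::metric_space \<Rightarrow> real) set topology" where
  "Cstar_topology = topology (\<lambda>V. V \<subseteq> cont_fun // const_rel \<and>
     openin ucb_topology {f \<in> cont_fun. fun_class f \<in> V})"

lemma openin_Cstar_topology:
  "openin Cstar_topology V \<longleftrightarrow> V \<subseteq> cont_fun // const_rel \<and>
     openin ucb_topology {f \<in> cont_fun. fun_class f \<in> V}"
proof -
  have "istopology (\<lambda>V::('a \<Rightarrow> real) set set. V \<subseteq> cont_fun // const_rel \<and>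
     openin ucb_topology {f \<in> cont_fun. fun_class f \<in> V})" (is "istopology ?L")
    unfolding istopology_def
  proof (intro conjI allI impI)
    fix S T :: "('a \<Rightarrow> real) set set" assume "?L S" "?L T"
    moreover have "{f \<in> cont_fun. fun_class f \<in> S \<inter> T} =
        {f \<in> cont_fun. fun_class f \<in> S} \<inter> {f \<in> cont_fun. fun_class f \<in> T}" by blast
    ultimately show "S \<inter> T \<subseteq> cont_fun // const_rel"
      "openin ucb_topology {f \<in> cont_fun. fun_class f \<in> S \<inter> T}"
      by auto
  next
    fix \<K> :: "('a \<Rightarrow> real) set set set" assume K: "\<forall>K\<in>\<K>. ?L K"
    then show "\<Union>\<K> \<subseteq> cont_fun // const_rel" by blast
    have "{f \<in> cont_fun. fun_class f \<in> \<Union>\<K>} = (\<Union>K\<in>\<K>. {f \<in> cont_fun. fun_class f \<in> K})"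
      by blast
    then show "openin ucb_topology {f \<in> cont_fun. fun_class f \<in> \<Union>\<K>}"
      using K by auto
  qed
  then show ?thesis by (simp add: Cstar_topology_def)
qed

definition horo_embed :: "'a::metric_space \<Rightarrow> ('a \<Rightarrow> real) set" where
  "horo_embed x = fun_class (\<lambda>y. dist x y)"

definition horo_compactification :: "('a::metric_space \<Rightarrow> real) set set" where
  "horo_compactification = Cstar_topology closure_of (range horo_embed)"

definition horo_boundary :: "('a::metric_space \<Rightarrow> real) set set" where
  "horo_boundary = horo_compactification - range horo_embed"

definition horofunction :: "('a::metric_space \<Rightarrow> real) \<Rightarrow> bool" where
  "horofunction \<Phi> \<longleftrightarrow> \<Phi> \<in> cont_fun \<and> fun_class \<Phi> \<in> horo_boundary"

definition horoball :: "('a::metric_space \<Rightarrow> real) \<Rightarrow> 'a \<Rightarrow> 'a set" where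
  "horoball \<Phi> y = {x. \<Phi> x \<le> \<Phi> y}"

definition horosphere :: "('a::metric_space \<Rightarrow> real) \<Rightarrow> 'a \<Rightarrow> 'a set" where
  "horosphere \<Phi> y = {x. \<Phi> x = \<Phi> y}"


section \<open>Horoballs and horospheres at infinity\<close>

definition decreases_sublinearly :: "(real \<Rightarrow> real) \<Rightarrow> bool" where
  "decreases_sublinearly f \<longleftrightarrow> (\<exists>k<0. \<exists>b. \<forall>t\<ge>0. f t \<le> k * t + b)"

text \<open>
  The relations $\mathrm{Td}([\Phi],\xi)\le\pi/2$, $<\pi/2$, $\ge\pi/2$, $=\pi/2$; they are
  unchanged when a constant is added to \<open>\<Phi>\<close>.
\<close>

definition Td_le_half_pi ::
    "('a::metric_space \<Rightarrow> real) \<Rightarrow> (real \<Rightarrow> 'a) set \<Rightarrow> bool" where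
  "Td_le_half_pi \<Phi> \<xi> \<longleftrightarrow> (\<exists>c. ray c \<and> endpoint c = \<xi> \<and> antimono_on {0..} (\<Phi> \<circ> c))"

definition Td_less_half_pi ::
    "('a::metric_space \<Rightarrow> real) \<Rightarrow> (real \<Rightarrow> 'a) set \<Rightarrow> bool" where
  "Td_less_half_pi \<Phi> \<xi> \<longleftrightarrow>
     (\<forall>c. ray c \<longrightarrow> endpoint c = \<xi> \<longrightarrow> decreases_sublinearly (\<Phi> \<circ> c))"

definition Td_ge_half_pi ::
    "('a::metric_space \<Rightarrow> real) \<Rightarrow> (real \<Rightarrow> 'a) set \<Rightarrow> bool" where
  "Td_ge_half_pi \<Phi> \<xi> \<longleftrightarrow> \<not> Td_less_half_pi \<Phi> \<xi>"

definition Td_eq_half_pi ::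
    "('a::metric_space \<Rightarrow> real) \<Rightarrow> (real \<Rightarrow> 'a) set \<Rightarrow> bool" where
  "Td_eq_half_pi \<Phi> \<xi> \<longleftrightarrow> Td_le_half_pi \<Phi> \<xi> \<and> Td_ge_half_pi \<Phi> \<xi>"

definition horoball_at_infinity ::
    "('a::metric_space \<Rightarrow> real) \<Rightarrow> (real \<Rightarrow> 'a) set set" where
  "horoball_at_infinity \<Phi> = {\<xi> \<in> geo_boundary. Td_le_half_pi \<Phi> \<xi>}"

definition horosphere_at_infinity ::
    "('a::metric_space \<Rightarrow> real) \<Rightarrow> (real \<Rightarrow> 'a) set set" where
  "horosphere_at_infinity \<Phi> = {\<xi> \<in> geo_boundary. Td_eq_half_pi \<Phi> \<xi>}"

definition geo_closure :: "'a::metric_space \<Rightarrow> 'a set \<Rightarrow> 'a geo_point set" where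
  "geo_closure p A = cone_topology p closure_of (Inl ` A)"

end

theory Submission
  imports Defs "HOL-Real_Asymp.Real_Asymp"
begin

text \<open>
  A horofunction \<open>\<Phi>\<close> is a locally uniform limit of normalized distance functions, hence
  1-Lipschitz and convex along geodesics. A convex function on a half-line that is bounded above is
  non-increasing. In a limit of points of the horoball the segments from \<open>p\<close> keep \<open>\<Phi>\<close> below
  \<open>max (\<Phi> p) (\<Phi> y)\<close>, so \<open>\<Phi>\<close> is non-increasing along the limit ray; conversely the ray from \<open>y\<close> to
  a point of the horoball at infinity stays in the horoball.

  If the limit direction is in the horosphere at infinity, then \<open>h n = \<Phi> y - \<Phi> (c n)\<close> is
  \<open>o(n)\<close> along the ray \<open>c\<close> from \<open>y\<close>, by convexity. Prolonging backwards a geodesic that descends from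
  \<open>c n\<close> at unit speed reaches the horosphere at distance exactly \<open>h n\<close> from \<open>c n\<close>, and points at
  distance \<open>o(n)\<close> from \<open>c n\<close> converge to the endpoint of \<open>c\<close>.
\<close>

section \<open>Convex functions on a half-line\<close>

text \<open>If \<open>f s < f t\<close>, convexity keeps \<open>f\<close> beyond \<open>t\<close>
  above the rising chord through these two points, and the chord eventually exceeds
  \<open>M\<close>.\<close>

lemma convex_on_bounded_above_imp_antimono:
  fixes f :: "real \<Rightarrow> real"
  assumes f: "convex_on {0..} f" and M: "\<And>t. t \<ge> 0 \<Longrightarrow> f t \<le> M"
  shows "antimono_on {0..} f"
proof (rule monotone_onI)
  fix s t :: real assume st: "s \<in> {0..}" "t \<in> {0..}" "s \<le> t"
  show "f t \<le> f s"
  proof (rule ccontr)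
    assume "\<not> f t \<le> f s"
    then have less: "f s < f t" by simp
    with st have "s < t" by (cases "s = t") auto
    \<comment> \<open>At \<open>u\<close> the chord through \<open>(s, f s)\<close> and
      \<open>(t, f t)\<close> has height \<open>M + 1 + (f t - f s)\<close>, which exceeds
      \<open>M\<close>.\<close>
    define u where "u = t + (M - f s + 1) * (t - s) / (f t - f s)"
    have "f t \<le> M" using M st by auto
    then have "(M - f s + 1) * (t - s) / (f t - f s) > 0"
      using less \<open>s < t\<close> by (intro divide_pos_pos mult_pos_pos) auto
    then have "u > t" by (simp add: u_def)
    have u: "(u - s) * (f t - f s) = (t - s) * (f t - f s) + (M - f s + 1) * (t - s)"
      unfolding u_def using less by (simp add: field_simps)
    define l where "l = (t - s) / (u - s)"
    have l: "0 \<le> l" "l \<le> 1" using \<open>s < t\<close> \<open>t < u\<close> by (auto simp: l_def)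
    have "(1 - l) *\<^sub>R s + l *\<^sub>R u = s + l * (u - s)" by (simp add: algebra_simps)
    also have "\<dots> = t" using \<open>s < t\<close> \<open>t < u\<close> by (simp add: l_def)
    finally have "f t \<le> (1 - l) * f s + l * f u"
      using convex_onD[OF f l, of s u] st \<open>t < u\<close> by auto
    also have "\<dots> \<le> (1 - l) * f s + l * M"
      using M[of u] l st \<open>t < u\<close> by (intro add_left_mono mult_left_mono) auto
    finally have "f t - f s \<le> l * (M - f s)" by (simp add: algebra_simps)
    then have "(u - s) * (f t - f s) \<le> (u - s) * (l * (M - f s))"
      using \<open>s < t\<close> \<open>t < u\<close> by (intro mult_left_mono) auto
    also have "\<dots> = (t - s) * (M - f s)" using \<open>s < t\<close> \<open>t < u\<close> by (simp add: l_def)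
    finally have "(t - s) * (f t - f s) + (t - s) \<le> 0" unfolding u by (simp add: algebra_simps)
    moreover have "(t - s) * (f t - f s) > 0" using less \<open>s < t\<close> by simp
    ultimately show False using \<open>s < t\<close> by linarith
  qed
qed

text \<open>Failure of sublinear decrease, tested with slope \<open>- e\<close> and intercept
  \<open>f 0\<close>, gives one point \<open>t0\<close> where \<open>f\<close> lies above the line
  starting at \<open>f 0\<close>. A convex function cannot return below that line later.\<close>

lemma convex_on_not_decreases_sublinearly:
  fixes f :: "real \<Rightarrow> real"
  assumes f: "convex_on {0..} f" and nd: "\<not> decreases_sublinearly f" and "e > 0"
  shows "\<forall>\<^sub>F t in at_top. f 0 - f t \<le> e * t"
proof -
  obtain t0 where t0: "t0 \<ge> 0" "f t0 > - e * t0 + f 0"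
    using nd \<open>e > 0\<close> unfolding decreases_sublinearly_def
    by (metis not_le neg_less_0_iff_less)
  then have "t0 > 0" by (cases "t0 = 0") auto
  have "f 0 - f t \<le> e * t" if "t \<ge> t0" for t
  proof -
    define l where "l = t0 / t"
    have l: "0 \<le> l" "l \<le> 1" using \<open>t0 > 0\<close> that by (auto simp: l_def)
    have lt: "l * t = t0" using \<open>t0 > 0\<close> that by (simp add: l_def)
    then have "f t0 \<le> (1 - l) * f 0 + l * f t"
      using convex_onD[OF f l, of 0 t] \<open>t0 > 0\<close> that by simp
    then have "l * (f 0 - f t) \<le> l * (e * t)" using t0 lt by (simp add: algebra_simps)
    moreover have "l > 0" using \<open>t0 > 0\<close> that by (simp add: l_def)
    ultimately show ?thesis by simp
  qed
  then show ?thesis unfolding eventually_at_top_linorder by blast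
qed

section \<open>Geodesics and rays\<close>

lemma geodesic_onD: "geodesic_on S c \<Longrightarrow> s \<in> S \<Longrightarrow> t \<in> S \<Longrightarrow> dist (c s) (c t) = \<bar>s - t\<bar>"
  by (simp add: geodesic_on_def)

lemma geodesic_on_subset: "geodesic_on S c \<Longrightarrow> T \<subseteq> S \<Longrightarrow> geodesic_on T c"
  by (auto simp: geodesic_on_def)

lemma affine_segment_geodesic:
  "geodesic_on {a..b} c \<Longrightarrow> a \<le> b \<Longrightarrow> affine_segment a b c"
  unfolding affine_segment_def geodesic_on_def by (auto intro!: exI[of _ 1])

lemma affine_segment_const: "affine_segment 0 0 (\<lambda>_. x)"
  unfolding affine_segment_def by (auto intro!: exI[of _ 1])

lemma ray_dist: "ray c \<Longrightarrow> s \<ge> 0 \<Longrightarrow> t \<ge> 0 \<Longrightarrow> dist (c s) (c t) = \<bar>s - t\<bar>"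
  by (simp add: ray_def geodesic_on_def)

lemma ray_geodesic: "ray c \<Longrightarrow> a \<ge> 0 \<Longrightarrow> geodesic_on {a..b} c"
  unfolding ray_def by (erule geodesic_on_subset) auto

section \<open>Convexity of the distance between geodesics\<close>

lemma busemann_segment:
  fixes x y :: "'a::metric_space"
  assumes "busemann_space TYPE('a)"
  obtains c where "geodesic_on {0..dist x y} c" "c 0 = x" "c (dist x y) = y"
  using assms unfolding busemann_space_def geodesic_space_def by blast

text \<open>Joint convexity on the rectangle is evaluated along its diagonal, so segments of
  different lengths are compared at equal fractions of their lengths.\<close>

lemma busemann_dist_convex:
  fixes c c' :: "real \<Rightarrow> 'a::metric_space"
  assumes "busemann_space TYPE('a)" "geodesic_on {a..b} c" "geodesic_on {a'..b'} c'"
    and "a \<le> b" "a' \<le> b'" "0 \<le> s" "s \<le> 1"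
  shows "dist (c ((1 - s) * a + s * b)) (c' ((1 - s) * a' + s * b'))
    \<le> (1 - s) * dist (c a) (c' a') + s * dist (c b) (c' b')"
proof -
  have "convex_on ({a..b} \<times> {a'..b'}) (\<lambda>(t, t'). dist (c t) (c' t'))"
    using assms affine_segment_geodesic unfolding busemann_space_def by blast
  from convex_onD[OF this, of s "(a, a')" "(b, b')"] show ?thesis using assms by simp
qed

text \<open>The point \<open>x\<close> is treated as a segment parameterized by the one-point
  interval \<open>{0..0}\<close>.\<close>

lemma busemann_dist_point_convex:
  fixes c :: "real \<Rightarrow> 'a::metric_space"
  assumes "busemann_space TYPE('a)" "geodesic_on {a..b} c" "a \<le> b" "0 \<le> s" "s \<le> 1"
  shows "dist x (c ((1 - s) * a + s * b)) \<le> (1 - s) * dist x (c a) + s * dist x (c b)"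
proof -
  have "convex_on ({0..0} \<times> {a..b}) (\<lambda>(t, t'). dist ((\<lambda>_::real. x) t) (c t'))"
    using assms affine_segment_geodesic affine_segment_const unfolding busemann_space_def by blast
  from convex_onD[OF this, of s "(0, a)" "(0, b)"] show ?thesis using assms by simp
qed

lemma busemann_dist_common_start:
  fixes c c' :: "real \<Rightarrow> 'a::metric_space"
  assumes "busemann_space TYPE('a)" "geodesic_on {0..T} c" "geodesic_on {0..T} c'"
    and "c 0 = c' 0" "0 \<le> t" "t \<le> T" "0 < T"
  shows "dist (c t) (c' t) \<le> t / T * dist (c T) (c' T)"
  using busemann_dist_convex[OF assms(1-3), of "t / T"] assms(4-) by simp

text \<open>If \<open>c t\<close> is within \<open>D\<close> of \<open>c' s\<close>, then
  \<open>s\<close> and \<open>t\<close> differ by a bounded amount, since each is the distance to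
  the start of its ray. Hence the Hausdorff distance can be traded for a bound at equal
  parameters.\<close>

lemma asymptotic_iff:
  "(c, c') \<in> asymptotic \<longleftrightarrow> ray c \<and> ray c' \<and> (\<exists>D. \<forall>t\<ge>0. dist (c t) (c' t) \<le> D)"
proof (intro iffI conjI; (elim conjE exE)?)
  assume asm: "(c, c') \<in> asymptotic"
  then show c: "ray c" "ray c'" by (auto simp: asymptotic_def)
  let ?f = "\<lambda>a. INF b\<in>c' ` {0..}. ereal (dist a b)"
  have "(SUP a\<in>c ` {0..}. ?f a) < \<infinity>"
    using asm by (auto simp: asymptotic_def hausdorff_dist_def)
  then obtain D :: real where D: "(SUP a\<in>c ` {0..}. ?f a) < ereal D"
    using less_PInf_Ex_of_nat by fastforce
  have "dist (c t) (c' t) \<le> 2 * D + dist (c 0) (c' 0)" if t: "t \<ge> 0" for t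
  proof -
    have "?f (c t) \<le> (SUP a\<in>c ` {0..}. ?f a)" using t by (intro SUP_upper) auto
    then have "?f (c t) < ereal D" using D by (rule le_less_trans)
    then obtain s where s: "s \<ge> 0" "dist (c t) (c' s) < D" by (auto simp: INF_less_iff)
    have "\<bar>t - s\<bar> \<le> D + dist (c 0) (c' 0)"
      using ray_dist[OF c(1), of 0 t] ray_dist[OF c(2), of 0 s] s t
        dist_triangle[of "c 0" "c t" "c' 0"] dist_triangle[of "c' 0" "c t" "c' s"]
        dist_triangle[of "c' 0" "c' s" "c 0"] dist_triangle[of "c 0" "c' s" "c t"]
      by (simp add: dist_commute)
    then show ?thesis
      using ray_dist[OF c(2), of s t] s t dist_triangle[of "c t" "c' t" "c' s"] by simp
  qed
  then show "\<exists>D. \<forall>t\<ge>0. dist (c t) (c' t) \<le> D" by blast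
next
  fix D assume c: "ray c" "ray c'" and D: "\<forall>t\<ge>0. dist (c t) (c' t) \<le> D"
  have "(SUP a\<in>c ` {0..}. INF b\<in>c' ` {0..}. ereal (dist a b)) \<le> ereal D"
    "(SUP b\<in>c' ` {0..}. INF a\<in>c ` {0..}. ereal (dist a b)) \<le> ereal D"
    using D by (auto intro!: SUP_least intro: INF_lower2)
  then have "hausdorff_dist (c ` {0..}) (c' ` {0..}) \<le> ereal D"
    by (simp add: hausdorff_dist_def)
  also have "\<dots> < \<infinity>" by simp
  finally show "(c, c') \<in> asymptotic" using c by (simp add: asymptotic_def)
qed

lemma equiv_asymptotic: "equiv {c :: real \<Rightarrow> 'a::metric_space. ray c} asymptotic" (is "equiv ?R ?a")
proof (rule equivI)
  show "?a \<subseteq> ?R \<times> ?R" by (auto simp: asymptotic_def)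
  show "refl_on ?R ?a" by (auto simp: refl_on_def asymptotic_iff intro: exI[of _ 0])
  show "sym ?a" by (rule symI) (auto simp: asymptotic_iff dist_commute)
  show "trans ?a"
  proof (rule transI)
    fix x y z :: "real \<Rightarrow> 'a"
    assume "(x, y) \<in> asymptotic" "(y, z) \<in> asymptotic"
    then obtain D E where *: "ray x" "ray y" "ray z" "\<forall>t\<ge>0. dist (x t) (y t) \<le> D"
      "\<forall>t\<ge>0. dist (y t) (z t) \<le> E" by (auto simp: asymptotic_iff)
    have "dist (x t) (z t) \<le> D + E" if "t \<ge> 0" for t
      using *(4,5)[rule_format, OF that] dist_triangle[of "x t" "z t" "y t"] by linarith
    then show "(x, z) \<in> asymptotic" unfolding asymptotic_iff using *(1,3) by blast
  qed
qed

section \<open>Rays representing a boundary point\<close>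

lemma endpoint_eq_iff:
  "ray c \<Longrightarrow> ray c' \<Longrightarrow> endpoint c = endpoint c' \<longleftrightarrow> (c, c') \<in> asymptotic"
  unfolding endpoint_def using eq_equiv_class_iff[OF equiv_asymptotic] by blast

lemma rays_same_endpoint_dist_bounded:
  assumes "ray c" "ray c'" "endpoint c = endpoint c'"
  obtains D where "\<And>t. t \<ge> 0 \<Longrightarrow> dist (c t) (c' t) \<le> D"
  using assms by (auto simp: endpoint_eq_iff asymptotic_iff)

text \<open>The ray from \<open>p\<close> is the limit of the segments from \<open>p\<close> to \<open>c n\<close>: these stay within bounded
  distance of \<open>c\<close>, so by convexity any two long ones are close to each other near \<open>p\<close>.\<close>

lemma exists_asymptotic_ray:
  fixes c :: "real \<Rightarrow> 'a::metric_space"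
  assumes bus: "busemann_space TYPE('a)" and proper: "proper_space TYPE('a)" and c: "ray c"
  obtains c' where "ray c'" "c' 0 = p" "endpoint c' = endpoint c"
proof -
  define D where "D = dist p (c 0)"
  define L where "L n = dist p (c (real n))" for n
  have "\<exists>g. geodesic_on {0..L n} g \<and> g 0 = p \<and> g (L n) = c (real n)" for n
    unfolding L_def by (rule busemann_segment[OF bus]) blast
  then obtain g where g: "\<And>n. geodesic_on {0..L n} (g n)" "\<And>n. g n 0 = p"
      "\<And>n. g n (L n) = c (real n)"
    by metis
  have D: "D \<ge> 0" by (simp add: D_def)
  have L: "\<bar>L n - real n\<bar> \<le> D" for n
    using ray_dist[OF c, of 0 "real n"] dist_triangle[of p "c (real n)" "c 0"]
      dist_triangle[of "c 0" "c (real n)" p]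
    by (simp add: L_def D_def dist_commute)
  have near_c: "dist (c t) (g n t) \<le> 2 * D" if t: "0 \<le> t" "0 < n" "t + D \<le> real n" for t n
  proof -
    have n: "real n > 0" "t \<le> n" "t \<le> L n" using t D L[of n] by auto
    \<comment> \<open>Ray and segment are first compared at the same fraction \<open>s\<close> of
      their lengths, giving \<open>D\<close>. Passing from parameter \<open>s * L n\<close> to
      \<open>t\<close> costs at most another \<open>D\<close>, because \<open>L n\<close> and
      \<open>n\<close> differ by at most \<open>D\<close>.\<close>
    define s where "s = t / n"
    have s: "0 \<le> s" "s \<le> 1" "s * n = t" using t n by (auto simp: s_def)
    have "dist (c (s * n)) (g n (s * L n)) \<le> (1 - s) * D"
      using busemann_dist_convex[OF bus ray_geodesic[OF c, of 0 "real n"] g(1)[of n], of s] s g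
      by (simp add: L_def D_def dist_commute)
    also have "\<dots> \<le> D" using s D by (simp add: mult_left_le_one_le)
    finally have 1: "dist (c t) (g n (s * L n)) \<le> D" by (simp add: s)
    have "s * L n \<le> L n" using s by (simp add: mult_left_le_one_le L_def)
    then have "dist (g n (s * L n)) (g n t) = \<bar>s * L n - t\<bar>"
      using n t s by (intro geodesic_onD[OF g(1)]) (auto simp: L_def)
    also have "s * L n - t = s * (L n - n)" using s by (simp add: algebra_simps)
    also have "\<bar>s * (L n - n)\<bar> \<le> 1 * D" unfolding abs_mult using s L[of n] by (intro mult_mono) auto
    finally show ?thesis using 1 dist_triangle[of "c t" "g n t" "g n (s * L n)"] by simp
  qed
  \<comment> \<open>Both segments start at \<open>p\<close>, so their distance at \<open>T\<close>,
    at most \<open>4 * D\<close>, is scaled down by \<open>t / T\<close>; this is small when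
    \<open>T\<close> is large.\<close>
  have close: "dist (g m t) (g n t) \<le> t / T * (4 * D)"
    if "0 \<le> t" "t \<le> T" "0 < T" "T + D \<le> real m" "T + D \<le> real n" for t T m n
  proof -
    have mn: "m > 0" "n > 0" "T \<le> L m" "T \<le> L n" using that D L[of m] L[of n] by auto
    have "dist (g m t) (g n t) \<le> t / T * dist (g m T) (g n T)"
      using mn that g
      by (intro busemann_dist_common_start[OF bus]) (auto intro: geodesic_on_subset[OF g(1)])
    also have "dist (g m T) (g n T) \<le> 4 * D"
      using near_c[of T m] near_c[of T n] mn that dist_triangle[of "g m T" "g n T" "c T"]
      by (simp add: dist_commute)
    finally show ?thesis using that by (simp add: mult_left_mono divide_right_mono)
  qed
  have "\<exists>l. (\<lambda>n. g n t) \<longlonglongrightarrow> l" if t: "t \<ge> 0" for t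
  proof -
    have "Cauchy (\<lambda>n. g n t)"
    proof (rule metric_CauchyI)
      fix e :: real assume e: "e > 0"
      \<comment> \<open>Solves \<open>t / T * (4 * D) < e\<close>; the summand 1 makes the
        inequality strict and \<open>T\<close> positive even for \<open>t = 0\<close>.\<close>
      define T where "T = t + 4 * t * D / e + 1"
      have T: "t \<le> T" "T > 0" using t D e by (auto simp: T_def add_nonneg_pos)
      have "T * e = t * (4 * D) + (t * e + e)" using e by (simp add: T_def field_simps)
      moreover have "t * e + e > 0" using t e by (simp add: add_nonneg_pos)
      ultimately have "t * (4 * D) < T * e" by linarith
      then have *: "t / T * (4 * D) < e" using T by (simp add: field_simps)
      show "\<exists>M. \<forall>m\<ge>M. \<forall>n\<ge>M. dist (g m t) (g n t) < e"
      proof (intro exI[of _ "nat \<lceil>T + D\<rceil>"] allI impI)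
        fix m n assume "nat \<lceil>T + D\<rceil> \<le> m" "nat \<lceil>T + D\<rceil> \<le> n"
        then have "T + D \<le> real m" "T + D \<le> real n" by linarith+
        from close[OF t T this] * show "dist (g m t) (g n t) < e" by simp
      qed
    qed
    \<comment> \<open>Properness supplies completeness: the Cauchy sequence stays in one closed
      ball, which is compact.\<close>
    moreover from this have "bounded (range (\<lambda>n. g n t))" by (rule cauchy_imp_bounded)
    then obtain r where "\<forall>y\<in>range (\<lambda>n. g n t). dist p y \<le> r"
      by (auto simp: bounded_any_center[where a=p])
    then have "\<forall>n. g n t \<in> cball p r" by simp
    moreover have "complete (cball p r)"
      by (rule compact_imp_complete) (use proper in \<open>simp add: proper_space_def\<close>)
    ultimately show ?thesis unfolding complete_def by meson
  qed
  then obtain c' where c': "\<And>t. t \<ge> 0 \<Longrightarrow> (\<lambda>n. g n t) \<longlonglongrightarrow> c' t" by metis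
  have ge: "\<forall>\<^sub>F n in sequentially. T \<le> real n" for T
    by real_asymp
  have "ray c'" unfolding ray_def geodesic_on_def
  proof safe
    fix s t :: real assume st: "s \<ge> 0" "t \<ge> 0"
    have "(\<lambda>n. dist (g n s) (g n t)) \<longlonglongrightarrow> dist (c' s) (c' t)"
      using c' st by (intro tendsto_dist)
    moreover have "\<forall>\<^sub>F n in sequentially. dist (g n s) (g n t) = \<bar>s - t\<bar>"
      using ge[of "max s t + D"]
    proof eventually_elim
      case (elim n)
      then show ?case using L[of n] st by (intro geodesic_onD[OF g(1)]) auto
    qed
    ultimately show "dist (c' s) (c' t) = \<bar>s - t\<bar>"
      by (metis LIMSEQ_unique tendsto_eventually)
  qed
  moreover have "c' 0 = p" using c'[of 0] g(2) by (simp add: LIMSEQ_const_iff)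
  moreover have "dist (c t) (c' t) \<le> 2 * D" if t: "t \<ge> 0" for t
  proof (rule tendsto_upperbound)
    show "(\<lambda>n. dist (c t) (g n t)) \<longlonglongrightarrow> dist (c t) (c' t)" using c' t by (intro tendsto_intros)
    show "\<forall>\<^sub>F n in sequentially. dist (c t) (g n t) \<le> 2 * D"
      using ge[of "t + D + 1"] by eventually_elim (use t D near_c in auto)
  qed simp
  ultimately show ?thesis using c that[of c']
    by (auto simp: endpoint_eq_iff asymptotic_iff dist_commute)
qed

lemma ray_in_class:
  fixes p :: "'a::metric_space"
  assumes "busemann_space TYPE('a)" "proper_space TYPE('a)" "\<xi> \<in> geo_boundary"
  obtains c where "ray c" "c 0 = p" "endpoint c = \<xi>"
proof -
  obtain c0 where "ray c0" "\<xi> = endpoint c0"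
    using assms(3) unfolding geo_boundary_def endpoint_def quotient_def by auto
  then show ?thesis using exists_asymptotic_ray[OF assms(1,2)] that by metis
qed

section \<open>The cone topology\<close>

lemma geo_path_ray:
  fixes p :: "'a::metric_space"
  assumes "busemann_space TYPE('a)" "proper_space TYPE('a)" "\<xi> \<in> geo_boundary"
  shows "ray (geo_path p (Inr \<xi>))" "geo_path p (Inr \<xi>) 0 = p" "endpoint (geo_path p (Inr \<xi>)) = \<xi>"
proof -
  have *: "geo_path p (Inr \<xi>) = (SOME c. ray c \<and> c 0 = p \<and> endpoint c = \<xi>)" by (rule ext) simp
  have "\<exists>c. ray c \<and> c 0 = p \<and> endpoint c = \<xi>" using ray_in_class[OF assms, of p] by blast
  from someI_ex[OF this]
  show "ray (geo_path p (Inr \<xi>))" "geo_path p (Inr \<xi>) 0 = p" "endpoint (geo_path p (Inr \<xi>)) = \<xi>"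
    unfolding * by auto
qed

lemma geo_path_segment:
  fixes p :: "'a::metric_space"
  assumes "busemann_space TYPE('a)"
  shows "geodesic_on {0..dist p x} (geo_path p (Inl x))" "geo_path p (Inl x) 0 = p"
    "t \<ge> dist p x \<Longrightarrow> geo_path p (Inl x) t = x"
proof -
  let ?P = "\<lambda>c. geodesic_on {0..dist p x} c \<and> c 0 = p \<and> c (dist p x) = x"
  define c where "c = (SOME c. ?P c)"
  have "\<exists>c. ?P c" by (rule busemann_segment[OF assms]) blast
  from someI_ex[OF this] have c: "?P c" by (simp add: c_def)
  have *: "geo_path p (Inl x) t = c (min t (dist p x))" for t by (simp add: c_def)
  show "geodesic_on {0..dist p x} (geo_path p (Inl x))"
    using c unfolding geodesic_on_def * by simp
  show "geo_path p (Inl x) 0 = p" "t \<ge> dist p x \<Longrightarrow> geo_path p (Inl x) t = x"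
    using c unfolding * by (auto simp: min_def)
qed

text \<open>The segment to \<open>z n\<close> has length \<open>L n\<close> comparable to
  \<open>n\<close> and ends at distance \<open>o(n)\<close> from the ray. Convexity from the common
  start \<open>p\<close> scales this by \<open>t / L n\<close>, which leaves \<open>o(1)\<close> for
  bounded \<open>t\<close>.\<close>

lemma cone_converges_sublinear:
  fixes p :: "'a::metric_space"
  assumes bus: "busemann_space TYPE('a)" and proper: "proper_space TYPE('a)"
    and \<xi>: "\<xi> \<in> geo_boundary"
    and z: "(\<lambda>n. dist (z n) (geo_path p (Inr \<xi>) (real n)) / real n) \<longlonglongrightarrow> 0"
  shows "cone_converges p (\<lambda>n. Inl (z n)) (Inr \<xi>)"
proof -
  define r where "r = geo_path p (Inr \<xi>)"
  note r = geo_path_ray[OF bus proper \<xi>, of p, folded r_def]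
  define e where "e n = dist (z n) (r (real n))" for n
  have e0: "(\<lambda>n. e n / real n) \<longlonglongrightarrow> 0" using z by (simp add: e_def r_def)
  define L where "L n = dist p (z n)" for n
  have L: "\<bar>L n - real n\<bar> \<le> e n" for n
    using ray_dist[OF r(1), of 0 "real n"] dist_triangle[of p "z n" "r n"]
      dist_triangle[of p "r n" "z n"] r(2)
    by (simp add: L_def e_def dist_commute)
  have "\<forall>\<^sub>F n in sequentially. e n / real n < 1 / 2" using e0 by (rule order_tendstoD) simp
  then have half: "\<forall>\<^sub>F n in sequentially. real n / 2 \<le> L n"
    using eventually_gt_at_top[of 0]
  proof eventually_elim
    case (elim n)
    then show ?case using L[of n] by (simp add: field_simps)
  qed
  have Linf: "filterlim L at_top sequentially"
    by (rule filterlim_at_top_mono[OF _ half]) real_asymp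
  \<comment> \<open>The comparison from a common start needs equal parameters, so the ray is
    evaluated at \<open>L n\<close> instead of \<open>n\<close>, at the cost of one more
    \<open>e n\<close>.\<close>
  have dist_end: "dist (z n) (r (L n)) \<le> 2 * e n" for n
    using dist_triangle[of "z n" "r (L n)" "r n"] ray_dist[OF r(1), of "real n" "L n"] L[of n]
    by (simp add: e_def L_def)
  have "(\<lambda>i. geo_dist p (Inl (z i))) \<longlonglongrightarrow> geo_dist p (Inr \<xi>)"
    using Linf by (simp add: L_def[abs_def] tendsto_PInfty_eq_at_top)
  moreover have "uniform_limit B (\<lambda>i. geo_path p (Inl (z i))) (geo_path p (Inr \<xi>)) sequentially"
    if B: "B \<subseteq> {0..}" "bounded B" for B
  proof -
    obtain R where R: "R > 0" "\<And>t. t \<in> B \<Longrightarrow> t \<le> R" 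
      using B(2) unfolding bounded_pos by (auto simp: abs_le_iff)
    have lim: "(\<lambda>n. 4 * R * (e n / real n)) \<longlonglongrightarrow> 0" using tendsto_mult_left[OF e0, of "4 * R"] by simp
    show ?thesis unfolding uniform_limit_iff
    proof (intro allI impI)
      fix d :: real assume "d > 0"
      have "\<forall>\<^sub>F n in sequentially. 4 * R * (e n / real n) < d" using lim \<open>d > 0\<close> by (rule order_tendstoD)
      moreover have "\<forall>\<^sub>F n in sequentially. R \<le> L n" using Linf by (simp add: filterlim_at_top)
      ultimately show "\<forall>\<^sub>F n in sequentially. \<forall>t\<in>B.
          dist (geo_path p (Inl (z n)) t) (geo_path p (Inr \<xi>) t) < d"
        using half eventually_gt_at_top[of 0]
      proof eventually_elim
        case (elim n)
        show ?case
        proof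
          fix t assume "t \<in> B"
          then have t: "0 \<le> t" "t \<le> R" using B(1) R(2) by auto
          have Ln: "L n > 0" using R elim by linarith
          have "dist (geo_path p (Inl (z n)) t) (r t)
              \<le> t / L n * dist (geo_path p (Inl (z n)) (L n)) (r (L n))"
            using geo_path_segment[OF bus, of p "z n"] r ray_geodesic[OF r(1), of 0 "L n"] t elim Ln
            by (intro busemann_dist_common_start[OF bus]) (auto simp: L_def simp del: geo_path.simps)
          also have "geo_path p (Inl (z n)) (L n) = z n"
            by (rule geo_path_segment(3)[OF bus]) (simp add: L_def)
          also have "t / L n * dist (z n) (r (L n)) \<le> R / (real n / 2) * (2 * e n)"
            using t R Ln elim dist_end[of n] by (intro mult_mono frac_le) auto
          also have "\<dots> = 4 * R * (e n / real n)" by simp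
          also have "\<dots> < d" by fact
          finally show "dist (geo_path p (Inl (z n)) t) (geo_path p (Inr \<xi>) t) < d"
            by (simp add: r_def del: geo_path.simps)
        qed
      qed
    qed
  qed
  ultimately show ?thesis by (simp add: cone_converges_def del: geo_dist.simps geo_path.simps)
qed

lemma cone_limit_in_geo_closure:
  assumes "\<xi> \<in> geo_boundary" "\<And>n. z n \<in> A" "cone_converges p (\<lambda>n. Inl (z n)) (Inr \<xi>)"
  shows "Inr \<xi> \<in> geo_closure p A"
  unfolding geo_closure_def in_closure_of
proof (intro conjI allI impI)
  show \<xi>: "Inr \<xi> \<in> topspace (cone_topology p)"
    using assms(1) by (simp add: geo_compactification_def)
  fix T assume T: "Inr \<xi> \<in> T \<and> openin (cone_topology p) T"
  have "limitin (cone_topology p) (\<lambda>n. Inl (z n)) (Inr \<xi>) sequentially"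
    using assms(3) \<xi> by (subst limitin_cone_topology) (auto simp: geo_compactification_def)
  with T have "\<forall>\<^sub>F n in sequentially. Inl (z n) \<in> T" by (auto simp: limitin_def)
  then obtain n where "Inl (z n) \<in> T" by (auto simp: eventually_sequentially)
  then show "\<exists>y. y \<in> Inl ` A \<and> y \<in> T" using assms(2) by blast
qed

text \<open>Open sets are defined by sequences, so sequential closedness suffices: a sequence that
  is not eventually outside \<open>S\<close> has a subsequence inside \<open>S\<close> with the same
  limit.\<close>

lemma closedin_cone_topologyI:
  assumes S: "S \<subseteq> geo_compactification"
    and lim: "\<And>x l. (\<And>i. x i \<in> S) \<Longrightarrow> l \<in> geo_compactification \<Longrightarrow> cone_converges p x l \<Longrightarrow> l \<in> S"
  shows "closedin (cone_topology p) S"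
  unfolding closedin_def topspace_cone_topology openin_cone_topology
proof (intro conjI allI impI S)
  fix x l assume x: "\<forall>i. x i \<in> geo_compactification" and l: "l \<in> geo_compactification - S"
    and conv: "cone_converges p x l"
  show "\<forall>\<^sub>F i in sequentially. x i \<in> geo_compactification - S"
  proof (rule ccontr)
    assume "\<not> ?thesis"
    then have "\<exists>\<^sub>F i in sequentially. x i \<in> S"
      unfolding not_eventually using x by simp
    then have "infinite {i. x i \<in> S}"
      by (simp add: frequently_cofinite flip: cofinite_eq_sequentially)
    then obtain r :: "nat \<Rightarrow> nat" where r: "strict_mono r" "\<And>i. r i \<in> {i. x i \<in> S}"
      by (rule infinite_enumerate[THEN exE]) blast
    have "(\<lambda>i. geo_dist p (x (r i))) \<longlonglongrightarrow> geo_dist p l"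
      using LIMSEQ_subseq_LIMSEQ[OF _ r(1)] conv unfolding cone_converges_def o_def by blast
    moreover have "uniform_limit B (\<lambda>i. geo_path p (x (r i))) (geo_path p l) sequentially"
      if "B \<subseteq> {0..}" "bounded B" for B
      using conv that filterlim_subseq[OF r(1)] unfolding cone_converges_def
      by (blast intro: filterlim_compose[where g="\<lambda>i. geo_path p (x i)"])
    ultimately have "cone_converges p (\<lambda>i. x (r i)) l" by (simp add: cone_converges_def)
    then show False using lim[of "\<lambda>i. x (r i)" l] r(2) l by auto
  qed
qed blast

section \<open>Horofunctions\<close>

lemma equiv_const_rel: "equiv (cont_fun :: ('a::metric_space \<Rightarrow> real) set) const_rel" (is "equiv ?C ?r")
proof (rule equivI)
  show "?r \<subseteq> ?C \<times> ?C" by (auto simp: const_rel_def)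
  show "refl_on ?C ?r" by (auto simp: refl_on_def const_rel_def intro: exI[of _ 0])
  show "sym ?r"
  proof (rule symI)
    fix f g :: "'a \<Rightarrow> real" assume "(f, g) \<in> const_rel"
    then obtain k where "f \<in> cont_fun" "g \<in> cont_fun" "\<forall>x. g x = f x + k"
      by (auto simp: const_rel_def)
    then show "(g, f) \<in> const_rel" by (auto simp: const_rel_def intro!: exI[of _ "- k"])
  qed
  show "trans ?r" by (rule transI) (auto simp: const_rel_def add.assoc)
qed

lemma fun_class_eq_iff:
  "f \<in> cont_fun \<Longrightarrow> g \<in> cont_fun \<Longrightarrow> fun_class f = fun_class g \<longleftrightarrow> (\<exists>k. \<forall>x. g x = f x + k)"
  unfolding fun_class_def by (subst eq_equiv_class_iff[OF equiv_const_rel]) (auto simp: const_rel_def)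

section \<open>Horofunctions as limits of distance functions\<close>

lemma dist_in_cont_fun: "(\<lambda>y. dist x y) \<in> cont_fun"
  by (auto simp: cont_fun_def intro!: continuous_intros)

text \<open>The class of a shifted distance function lies in \<open>range horo_embed\<close>, which
  \<open>horo_boundary\<close> excludes. This later forces the approximating points to
  escape.\<close>

lemma horofunction_not_dist:
  assumes "horofunction \<Phi>"
  shows "\<exists>y. \<Phi> y \<noteq> dist x y + k"
proof (rule ccontr)
  assume "\<not> ?thesis"
  then have "fun_class (\<lambda>y. dist x y) = fun_class \<Phi>"
    using assms by (subst fun_class_eq_iff) (auto simp: dist_in_cont_fun horofunction_def)
  then show False using assms by (auto simp: horofunction_def horo_boundary_def horo_embed_def)
qed

text \<open>The functions approximating \<Phi> on \<open>B\<close> up to a constant form an open set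
  \<open>W\<close> that is a union of classes. Its image is therefore a neighbourhood of the class
  of \<Phi> in the quotient, and a point of the closure has some \<open>horo_embed x\<close> in
  it.\<close>

lemma horofunction_approx:
  assumes \<Phi>: "horofunction \<Phi>" and B: "bounded B" and e: "e > 0"
  obtains x k where "\<And>y. y \<in> B \<Longrightarrow> \<bar>\<Phi> y - (dist x y + k)\<bar> < e"
proof -
  \<comment> \<open>Asking for a uniform bound \<open>d < e\<close>, not just pointwise
    \<open>< e\<close>, leaves the margin \<open>(e - d) / 2\<close> that makes \<open>W\<close>
    open.\<close>
  define W where "W = {f \<in> cont_fun. \<exists>k. \<exists>d<e. \<forall>y\<in>B. \<bar>\<Phi> y - (f y + k)\<bar> \<le> d}"
  have W: "W \<subseteq> cont_fun" by (auto simp: W_def)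
  have cont: "\<Phi> \<in> cont_fun" using \<Phi> by (simp add: horofunction_def)
  have sat: "f \<in> W" if g: "g \<in> W" and f: "f \<in> cont_fun" "fun_class f = fun_class g" for f g
  proof -
    obtain d k where "d < e" "\<forall>y\<in>B. \<bar>\<Phi> y - (g y + k)\<bar> \<le> d" "g \<in> cont_fun"
      using g unfolding W_def by blast
    moreover obtain k' where "\<forall>x. g x = f x + k'"
      using f g by (auto simp: fun_class_eq_iff W_def)
    ultimately show ?thesis using f(1)
      by (simp add: W_def add.assoc) blast
  qed
  have "{f \<in> cont_fun. fun_class f \<in> fun_class ` W} = W"
    using sat W by blast
  moreover have "openin ucb_topology W"
    unfolding openin_ucb_topology
  proof (intro conjI ballI)
    show "W \<subseteq> cont_fun" by (fact W)
    fix f assume "f \<in> W"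
    then obtain k d where d: "d < e" "\<forall>y\<in>B. \<bar>\<Phi> y - (f y + k)\<bar> \<le> d" by (auto simp: W_def)
    have "{g \<in> cont_fun. \<forall>x\<in>B. \<bar>g x - f x\<bar> < (e - d) / 2} \<subseteq> W"
    proof safe
      fix g assume g: "g \<in> cont_fun" "\<forall>x\<in>B. \<bar>g x - f x\<bar> < (e - d) / 2"
      have "\<bar>\<Phi> y - (g y + k)\<bar> \<le> d + (e - d) / 2" if "y \<in> B" for y
        using bspec[OF d(2) that] bspec[OF g(2) that] by linarith
      moreover have "d + (e - d) / 2 < e" using d(1) by (simp add: field_simps)
      ultimately show "g \<in> W" using g(1) by (auto simp: W_def)
    qed
    then show "\<exists>B e. bounded B \<and> 0 < e \<and> {g \<in> cont_fun. \<forall>x\<in>B. \<bar>g x - f x\<bar> < e} \<subseteq> W"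
      using B d(1) by (intro exI[of _ B] exI[of _ "(e - d) / 2"]) auto
  qed
  moreover have "fun_class ` W \<subseteq> cont_fun // const_rel"
    by (auto simp: W_def fun_class_def intro: quotientI)
  ultimately have op: "openin Cstar_topology (fun_class ` W)" by (simp add: openin_Cstar_topology)
  have "\<Phi> \<in> W" using cont e by (auto simp: W_def intro!: exI[of _ 0])
  then have mem: "fun_class \<Phi> \<in> fun_class ` W" by (rule imageI)
  have "fun_class \<Phi> \<in> Cstar_topology closure_of (range horo_embed)"
    using \<Phi> by (simp add: horofunction_def horo_boundary_def horo_compactification_def)
  then have "\<exists>F. F \<in> range horo_embed \<and> F \<in> fun_class ` W"
    using op mem unfolding in_closure_of by simp
  then obtain x g where "fun_class (\<lambda>y. dist x y) = fun_class g" "g \<in> W"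
    unfolding horo_embed_def by blast
  then have "(\<lambda>y. dist x y) \<in> W" using sat[OF _ dist_in_cont_fun] by simp
  then obtain k d where "d < e" "\<forall>y\<in>B. \<bar>\<Phi> y - (dist x y + k)\<bar> \<le> d" by (auto simp: W_def)
  then show ?thesis using that[of x k] by fastforce
qed

text \<open>The triangle inequality for \<open>dist x\<close> passes to \<Phi> by approximation on
  the two points \<open>y\<close> and \<open>z\<close>.\<close>

lemma horofunction_Lipschitz:
  assumes "horofunction \<Phi>"
  shows "\<bar>\<Phi> y - \<Phi> z\<bar> \<le> dist y z"
proof (rule field_le_epsilon)
  fix e :: real assume "e > 0"
  obtain x k where "\<And>w. w \<in> {y, z} \<Longrightarrow> \<bar>\<Phi> w - (dist x w + k)\<bar> < e / 2"
    using horofunction_approx[OF assms, of "{y, z}" "e / 2"] \<open>e > 0\<close> by auto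
  then have "\<bar>\<Phi> y - (dist x y + k)\<bar> < e / 2" "\<bar>\<Phi> z - (dist x z + k)\<bar> < e / 2" by blast+
  then show "\<bar>\<Phi> y - \<Phi> z\<bar> \<le> dist y z + e"
    using dist_triangle[of x y z] dist_triangle[of x z y] dist_commute[of y z] by linarith
qed

text \<open>\<open>dist x\<close> is convex along \<open>c\<close>. Each convexity inequality
  involves three points only, so approximation on these three transfers it to \<Phi>.\<close>

lemma horofunction_convex:
  fixes c :: "real \<Rightarrow> 'a::metric_space"
  assumes bus: "busemann_space TYPE('a)" and \<Phi>: "horofunction \<Phi>" and c: "geodesic_on S c" "convex S"
  shows "convex_on S (\<Phi> \<circ> c)"
proof (rule convex_on_linorderI)
  fix s a b :: real assume s: "0 < s" "s < 1" and ab: "a \<in> S" "b \<in> S" "a < b"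
  let ?u = "(1 - s) * a + s * b"
  have "{a..b} \<subseteq> S"
    using c(2) ab by (metis closed_segment_eq_real_ivl1 closed_segment_subset less_imp_le)
  then have geo: "geodesic_on {a..b} c" using c(1) geodesic_on_subset by blast
  have "\<Phi> (c ?u) \<le> (1 - s) * \<Phi> (c a) + s * \<Phi> (c b)"
  proof (rule field_le_epsilon)
    fix e :: real assume "e > 0"
    obtain x k where "\<And>w. w \<in> {c a, c b, c ?u} \<Longrightarrow> \<bar>\<Phi> w - (dist x w + k)\<bar> < e / 2"
      using horofunction_approx[OF \<Phi>, of "{c a, c b, c ?u}" "e / 2"] \<open>e > 0\<close> by auto
    then have x: "\<bar>\<Phi> (c a) - (dist x (c a) + k)\<bar> < e / 2"
      "\<bar>\<Phi> (c b) - (dist x (c b) + k)\<bar> < e / 2" "\<bar>\<Phi> (c ?u) - (dist x (c ?u) + k)\<bar> < e / 2"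
      by blast+
    have "\<Phi> (c ?u) \<le> dist x (c ?u) + k + e / 2" using x(3) by linarith
    also have "dist x (c ?u) \<le> (1 - s) * dist x (c a) + s * dist x (c b)"
      using busemann_dist_point_convex[OF bus geo] s ab by simp
    also have "\<dots> \<le> (1 - s) * (\<Phi> (c a) - k + e / 2) + s * (\<Phi> (c b) - k + e / 2)"
      using x(1,2) s by (intro add_mono mult_left_mono) linarith+
    finally show "\<Phi> (c ?u) \<le> (1 - s) * \<Phi> (c a) + s * \<Phi> (c b) + e"
      by (simp add: field_simps)
  qed
  then show "(\<Phi> \<circ> c) ((1 - s) *\<^sub>R a + s *\<^sub>R b) \<le> (1 - s) * (\<Phi> \<circ> c) a + s * (\<Phi> \<circ> c) b" by simp
qed (fact c)

lemma horofunction_antimono_along_ray: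
  fixes c :: "real \<Rightarrow> 'a::metric_space"
  assumes bus: "busemann_space TYPE('a)" and \<Phi>: "horofunction \<Phi>" and c: "ray c"
    and M: "\<And>t. t \<ge> 0 \<Longrightarrow> \<Phi> (c t) \<le> M"
  shows "antimono_on {0..} (\<Phi> \<circ> c)"
  using horofunction_convex[OF bus \<Phi>, of "{0..}" c] c M
  by (intro convex_on_bounded_above_imp_antimono[where M=M]) (auto simp: ray_def)

text \<open>Passes from some ray to every ray of the class: bounded distance and the Lipschitz
  property bound \<Phi> from above along \<open>c\<close>, and convexity then gives
  monotonicity.\<close>

lemma Td_le_half_pi_antimono:
  fixes c :: "real \<Rightarrow> 'a::metric_space"
  assumes bus: "busemann_space TYPE('a)" and \<Phi>: "horofunction \<Phi>" and c: "ray c" "endpoint c = \<xi>"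
    and Td: "Td_le_half_pi \<Phi> \<xi>"
  shows "antimono_on {0..} (\<Phi> \<circ> c)"
proof -
  obtain c0 where c0: "ray c0" "endpoint c0 = \<xi>" "antimono_on {0..} (\<Phi> \<circ> c0)"
    using Td by (auto simp: Td_le_half_pi_def)
  obtain D where D: "\<And>t. t \<ge> 0 \<Longrightarrow> dist (c t) (c0 t) \<le> D"
    using rays_same_endpoint_dist_bounded[OF c(1) c0(1)] c(2) c0(2) by metis
  have "\<Phi> (c t) \<le> \<Phi> (c0 0) + D" if "t \<ge> 0" for t
    using D[OF that] horofunction_Lipschitz[OF \<Phi>, of "c t" "c0 t"]
      monotone_onD[OF c0(3), of 0 t] that by simp
  then show ?thesis by (rule horofunction_antimono_along_ray[OF bus \<Phi> c(1)])
qed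

text \<open>The points \<open>x\<close> for which \<open>\<Phi>\<close> is close to \<open>dist x\<close> up to a constant leave every bounded set, and
  \<open>dist x\<close> decreases with slope \<open>-1\<close> along the segment from \<open>w\<close> to \<open>x\<close>.\<close>

lemma horofunction_descent:
  fixes w :: "'a::metric_space"
  assumes bus: "busemann_space TYPE('a)" and proper: "proper_space TYPE('a)" and \<Phi>: "horofunction \<Phi>"
  obtains z where "dist w z = 1" "\<Phi> z = \<Phi> w - 1"
proof -
  define e where "e n = inverse (real (Suc n))" for n
  have e: "e n > 0" "e \<longlonglongrightarrow> 0" for n
    using LIMSEQ_inverse_real_of_nat by (simp_all add: e_def[abs_def])
  \<comment> \<open>The radius \<open>real n + 1\<close> ensures that every approximation is valid
    on the whole unit ball about \<open>w\<close>.\<close>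
  have "\<exists>x k. \<forall>y\<in>cball w (real n + 1). \<bar>\<Phi> y - (dist x y + k)\<bar> < e n" for n
    using horofunction_approx[OF \<Phi> bounded_cball e(1)] by metis
  then obtain x k where x: "\<And>n y. y \<in> cball w (real n + 1) \<Longrightarrow> \<bar>\<Phi> y - (dist (x n) y + k n)\<bar> < e n"
    by metis
  have compact: "compact (cball w 1)" using proper by (simp add: proper_space_def)
  \<comment> \<open>Otherwise a tail of \<open>x\<close> stays in a compact ball and a subsequence
    converges to some \<open>l\<close>. Differences cancel the constants \<open>k n\<close>, so
    \<Phi> would be \<open>dist l\<close> up to a constant.\<close>
  have far: "\<exists>n\<ge>N. dist w (x n) \<ge> 1" for N
  proof (rule ccontr)
    assume "\<not> ?thesis"
    then have "\<forall>n. x (n + N) \<in> cball w 1"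
      by (metis le_add2 linorder_not_le less_imp_le mem_cball)
    then obtain l r where l: "strict_mono r" "((\<lambda>n. x (n + N)) \<circ> r) \<longlonglongrightarrow> l"
      using compact unfolding compact_def by metis
    define m where "m n = r n + N" for n
    have m: "strict_mono m" using l(1) by (simp add: m_def strict_mono_def)
    have xl: "(\<lambda>n. x (m n)) \<longlonglongrightarrow> l" using l(2) by (simp add: o_def m_def)
    have e2: "(\<lambda>n. 2 * e (m n)) \<longlonglongrightarrow> 0"
      using tendsto_mult_left[OF LIMSEQ_subseq_LIMSEQ[OF e(2) m], of 2] by (simp add: o_def)
    have "\<Phi> y - \<Phi> w = dist l y - dist l w" for y
    proof (rule LIMSEQ_unique)
      show "(\<lambda>n. dist (x (m n)) y - dist (x (m n)) w) \<longlonglongrightarrow> dist l y - dist l w"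
        using xl by (intro tendsto_intros)
      have "\<forall>\<^sub>F n in sequentially. dist w y \<le> real n" by real_asymp
      then have "\<forall>\<^sub>F n in sequentially.
          norm ((dist (x (m n)) y - dist (x (m n)) w) - (\<Phi> y - \<Phi> w)) \<le> 2 * e (m n)"
      proof eventually_elim
        case (elim n)
        have "n \<le> m n" using m by (rule seq_suble)
        then have "y \<in> cball w (real (m n) + 1)" "w \<in> cball w (real (m n) + 1)" using elim by auto
        from x[OF this(1)] x[OF this(2)] show ?case by (simp add: abs_less_iff abs_le_iff)
      qed
      from Lim_null_comparison[OF this e2]
      show "(\<lambda>n. dist (x (m n)) y - dist (x (m n)) w) \<longlonglongrightarrow> \<Phi> y - \<Phi> w"
        by (rule LIM_zero_cancel)
    qed
    then have "\<Phi> y = dist l y + (\<Phi> w - dist l w)" for y by (simp add: algebra_simps)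
    then show False using horofunction_not_dist[OF \<Phi>] by blast
  qed
  have "continuous_on (cball w 1) \<Phi>"
    using \<Phi> by (auto simp: horofunction_def cont_fun_def intro: continuous_on_subset)
  \<comment> \<open>The minimizer on the unit ball is the witness: unit steps towards far
    \<open>x n\<close> bring the minimum down to \<open>\<Phi> w - 1\<close>, and the Lipschitz
    property then forces distance 1 and equality.\<close>
  then obtain z where z: "z \<in> cball w 1" "\<And>y. y \<in> cball w 1 \<Longrightarrow> \<Phi> z \<le> \<Phi> y"
    using continuous_attains_inf[OF compact _ \<open>continuous_on (cball w 1) \<Phi>\<close>] by auto
  have "\<Phi> z \<le> \<Phi> w - 1"
  proof (rule field_le_epsilon)
    fix d :: real assume "d > 0"
    then have "\<forall>\<^sub>F n in sequentially. e n < d / 2" by (intro order_tendstoD[OF e(2)]) simp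
    then obtain N where "\<And>n. n \<ge> N \<Longrightarrow> e n < d / 2" by (auto simp: eventually_sequentially)
    with far[of N] obtain n where n: "dist w (x n) \<ge> 1" "e n < d / 2" by blast
    obtain c where c: "geodesic_on {0..dist w (x n)} c" "c 0 = w" "c (dist w (x n)) = x n"
      by (rule busemann_segment[OF bus])
    have "dist w (c 1) = 1" using geodesic_onD[OF c(1), of 0 1] c n by simp
    moreover have "dist (x n) (c 1) = dist (x n) w - 1"
      using geodesic_onD[OF c(1), of "dist w (x n)" 1] c n by (simp add: dist_commute)
    ultimately show "\<Phi> z \<le> \<Phi> w - 1 + d"
      using x[of "c 1" n] x[of w n] z(2)[of "c 1"] n by simp
  qed
  then show ?thesis using horofunction_Lipschitz[OF \<Phi>, of w z] z(1) that[of z] by simp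
qed

text \<open>A geodesic prolonging a descending one backwards gains height at full speed, by convexity.\<close>

lemma horofunction_ascent:
  fixes w :: "'a::metric_space"
  assumes bus: "busemann_space TYPE('a)" and proper: "proper_space TYPE('a)"
    and complete: "geodesically_complete TYPE('a)" and \<Phi>: "horofunction \<Phi>" and h: "h \<ge> 0"
  obtains z where "dist w z = h" "\<Phi> z = \<Phi> w + h"
proof -
  obtain v where v: "dist w v = 1" "\<Phi> v = \<Phi> w - 1" by (rule horofunction_descent[OF bus proper \<Phi>])
  obtain c where c: "geodesic_on {0..1} c" "c 0 = v" "c 1 = w"
    using busemann_segment[OF bus, of v w] v(1) by (metis dist_commute)
  then obtain l where l: "geodesic_on UNIV l" "\<forall>t\<in>{0..1}. l t = c t"
    using complete unfolding geodesically_complete_def by (metis zero_less_one)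
  then have l01: "l 0 = v" "l 1 = w" using c by auto
  \<comment> \<open>The weight for which \<open>1\<close> is the convex combination of
    \<open>0\<close> and \<open>1 + h\<close>. Since \<open>1 - s = s * h\<close>, the unit drop
    from \<open>w\<close> to \<open>v\<close> becomes a gain of at least \<open>h\<close> on the
    other side; the Lipschitz property bounds it by \<open>h\<close>.\<close>
  define s where "s = 1 / (1 + h)"
  have s: "0 \<le> s" "s \<le> 1" "s * (1 + h) = 1" "s > 0" using h by (auto simp: s_def)
  have "\<Phi> (l 1) \<le> (1 - s) * \<Phi> (l 0) + s * \<Phi> (l (1 + h))"
    using convex_onD[OF horofunction_convex[OF bus \<Phi> l(1)] s(1,2), of 0 "1 + h"] s(3) by simp
  then have "s * (\<Phi> w + h) \<le> s * \<Phi> (l (1 + h))"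
    using s(3) v(2) unfolding l01 by (simp add: algebra_simps)
  then have "\<Phi> w + h \<le> \<Phi> (l (1 + h))" using s by simp
  moreover have "dist w (l (1 + h)) = h"
    using geodesic_onD[OF l(1), of 1 "1 + h"] l01 h by simp
  ultimately show ?thesis
    using that[of "l (1 + h)"] horofunction_Lipschitz[OF \<Phi>, of w "l (1 + h)"] by simp
qed

section \<open>Closures of horoballs and horospheres\<close>

text \<open>This is the closedness of the union, so the terms \<open>q i\<close> may themselves lie
  at infinity.\<close>

lemma cone_limit_of_horoball:
  fixes p :: "'a::metric_space"
  assumes bus: "busemann_space TYPE('a)" and proper: "proper_space TYPE('a)" and \<Phi>: "horofunction \<Phi>"
    and q: "\<And>i. q i \<in> Inl ` horoball \<Phi> y \<union> Inr ` horoball_at_infinity \<Phi>"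
    and l: "l \<in> geo_compactification" and conv: "cone_converges p q l"
  shows "l \<in> Inl ` horoball \<Phi> y \<union> Inr ` horoball_at_infinity \<Phi>"
proof -
  have dist: "(\<lambda>i. geo_dist p (q i)) \<longlonglongrightarrow> geo_dist p l"
    and unif: "\<And>B. B \<subseteq> {0..} \<Longrightarrow> bounded B \<Longrightarrow>
      uniform_limit B (\<lambda>i. geo_path p (q i)) (geo_path p l) sequentially"
    using conv by (auto simp: cone_converges_def)
  have pointwise: "(\<lambda>i. geo_path p (q i) t) \<longlonglongrightarrow> geo_path p l t" if "t \<ge> 0" for t
    using unif[of "{t}"] that by (auto intro: tendsto_uniform_limitI)
  have isCont: "isCont \<Phi> x" for x
    using \<Phi> by (simp add: horofunction_def cont_fun_def continuous_on_eq_continuous_at)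
  show ?thesis
  proof (cases l)
    case (Inl x)
    \<comment> \<open>Eventually \<open>q i\<close> is a point at distance less than
      \<open>T\<close> from \<open>p\<close>, so its path has already reached its endpoint at time
      \<open>T\<close>. Cone convergence at \<open>T\<close> thus becomes convergence in the
      space.\<close>
    define T where "T = dist p x + 1"
    have "\<forall>\<^sub>F i in sequentially. geo_dist p (q i) < ereal T"
      by (rule order_tendstoD[OF dist]) (simp add: Inl T_def)
    then have "\<forall>\<^sub>F i in sequentially. \<Phi> (geo_path p (q i) T) \<le> \<Phi> y"
    proof eventually_elim
      case (elim i)
      then obtain z where z: "q i = Inl z" "z \<in> horoball \<Phi> y" using q[of i] by auto
      then have "geo_path p (q i) T = z"
        using elim unfolding z(1) by (intro geo_path_segment(3)[OF bus]) simp
      then show ?case using z(2) by (simp add: horoball_def)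
    qed
    moreover have "(\<lambda>i. geo_path p (q i) T) \<longlonglongrightarrow> x"
      using pointwise[of T] geo_path_segment(3)[OF bus, of p x T]
      by (simp add: Inl T_def add_nonneg_nonneg del: geo_path.simps)
    then have "(\<lambda>i. \<Phi> (geo_path p (q i) T)) \<longlonglongrightarrow> \<Phi> x" by (rule isCont_tendsto_compose[OF isCont])
    ultimately have "\<Phi> x \<le> \<Phi> y" by (intro tendsto_upperbound) auto
    then show ?thesis by (simp add: Inl horoball_def)
  next
    case (Inr \<xi>)
    have \<xi>: "\<xi> \<in> geo_boundary" using l by (auto simp: Inr geo_compactification_def)
    note r = geo_path_ray[OF bus proper \<xi>, of p]
    \<comment> \<open>By convexity, \<Phi> on a segment is at most the larger of its end values; on
      rays from \<open>p\<close> towards the horoball at infinity it is at most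
      \<open>\<Phi> p\<close>.\<close>
    define M where "M = max (\<Phi> p) (\<Phi> y)"
    have bound: "\<Phi> (geo_path p (q i) t) \<le> M" if t: "t \<ge> 0" for i t
    proof (cases "q i")
      case (Inl z)
      then have z: "\<Phi> z \<le> M" using q[of i] by (auto simp: horoball_def M_def)
      let ?c = "geo_path p (Inl z)"
      note c = geo_path_segment[OF bus, of p z]
      show ?thesis
      proof (cases "t < dist p z")
        case True
        define s where "s = t / dist p z"
        have s: "0 \<le> s" "s \<le> 1" "s * dist p z = t"
          using t True by (auto simp: s_def divide_le_eq_1)
        have "\<Phi> (?c t) \<le> (1 - s) * \<Phi> p + s * \<Phi> z"
          using convex_onD[OF horofunction_convex[OF bus \<Phi> c(1)] s(1,2), of 0 "dist p z"]
            c(2) c(3)[of "dist p z"] s(3) by (simp del: geo_path.simps)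
        also have "\<dots> \<le> (1 - s) * M + s * M"
          using z s by (intro add_mono mult_left_mono) (auto simp: M_def)
        finally show ?thesis by (simp add: Inl algebra_simps del: geo_path.simps)
      next
        case False
        then show ?thesis using z c(3)[of t] by (simp add: Inl del: geo_path.simps)
      qed
    next
      case (Inr \<eta>)
      then have \<eta>: "\<eta> \<in> geo_boundary" "Td_le_half_pi \<Phi> \<eta>"
        using q[of i] by (auto simp: horoball_at_infinity_def)
      note c = geo_path_ray[OF bus proper \<eta>(1), of p]
      have "\<Phi> (geo_path p (Inr \<eta>) t) \<le> \<Phi> p"
        using monotone_onD[OF Td_le_half_pi_antimono[OF bus \<Phi> c(1,3) \<eta>(2)], of 0 t] t c(2)
        by (simp del: geo_path.simps)
      then show ?thesis by (simp add: Inr M_def del: geo_path.simps)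
    qed
    have "\<Phi> (geo_path p (Inr \<xi>) t) \<le> M" if "t \<ge> 0" for t
    proof (rule tendsto_upperbound)
      show "(\<lambda>i. \<Phi> (geo_path p (q i) t)) \<longlonglongrightarrow> \<Phi> (geo_path p (Inr \<xi>) t)"
        using pointwise[OF that] unfolding Inr by (rule isCont_tendsto_compose[OF isCont])
      show "\<forall>\<^sub>F i in sequentially. \<Phi> (geo_path p (q i) t) \<le> M" using bound that by simp
    qed simp
    then have "antimono_on {0..} (\<Phi> \<circ> geo_path p (Inr \<xi>))"
      by (rule horofunction_antimono_along_ray[OF bus \<Phi> r(1)])
    then have "Td_le_half_pi \<Phi> \<xi>" using r unfolding Td_le_half_pi_def by blast
    then show ?thesis using \<xi> by (simp add: Inr horoball_at_infinity_def)
  qed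
qed

lemma geo_closure_horoball:
  fixes p :: "'a::metric_space"
  assumes bus: "busemann_space TYPE('a)" and proper: "proper_space TYPE('a)" and \<Phi>: "horofunction \<Phi>"
  shows "geo_closure p (horoball \<Phi> y) = Inl ` horoball \<Phi> y \<union> Inr ` horoball_at_infinity \<Phi>"
proof
  have "closedin (cone_topology p) (Inl ` horoball \<Phi> y \<union> Inr ` horoball_at_infinity \<Phi>)"
  proof (rule closedin_cone_topologyI)
    show "Inl ` horoball \<Phi> y \<union> Inr ` horoball_at_infinity \<Phi> \<subseteq> geo_compactification"
      by (auto simp: geo_compactification_def horoball_at_infinity_def)
  qed (rule cone_limit_of_horoball[OF bus proper \<Phi>])
  then show "geo_closure p (horoball \<Phi> y) \<subseteq> Inl ` horoball \<Phi> y \<union> Inr ` horoball_at_infinity \<Phi>"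
    unfolding geo_closure_def by (intro closure_of_minimal) auto
next
  have "Inl ` horoball \<Phi> y \<subseteq> geo_closure p (horoball \<Phi> y)"
    unfolding geo_closure_def by (intro closure_of_subset) (auto simp: geo_compactification_def)
  moreover have "Inr \<xi> \<in> geo_closure p (horoball \<Phi> y)" if "\<xi> \<in> horoball_at_infinity \<Phi>" for \<xi>
  proof -
    have \<xi>: "\<xi> \<in> geo_boundary" "Td_le_half_pi \<Phi> \<xi>"
      using that by (auto simp: horoball_at_infinity_def)
    obtain c where c: "ray c" "c 0 = y" "endpoint c = \<xi>" by (rule ray_in_class[OF bus proper \<xi>(1)])
    note r = geo_path_ray[OF bus proper \<xi>(1), of p]
    \<comment> \<open>The ray that stays in the horoball starts at \<open>y\<close>, while the cone
      topology uses rays from \<open>p\<close>. The bounded gap \<open>D\<close> disappears after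
      division by \<open>n\<close>.\<close>
    obtain D where D: "\<And>t. t \<ge> 0 \<Longrightarrow> dist (c t) (geo_path p (Inr \<xi>) t) \<le> D"
      using rays_same_endpoint_dist_bounded[OF c(1) r(1)] c(3) r(3) by metis
    have "c (real n) \<in> horoball \<Phi> y" for n
      using monotone_onD[OF Td_le_half_pi_antimono[OF bus \<Phi> c(1,3) \<xi>(2)], of 0 "real n"] c(2)
      by (simp add: horoball_def)
    moreover have "(\<lambda>n. dist (c (real n)) (geo_path p (Inr \<xi>) (real n)) / real n) \<longlonglongrightarrow> 0"
    proof (rule Lim_null_comparison)
      show "\<forall>\<^sub>F n in sequentially.
          norm (dist (c (real n)) (geo_path p (Inr \<xi>) (real n)) / real n) \<le> D / real n"
        using D by (intro always_eventually) (simp add: divide_right_mono del: geo_path.simps)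
      show "(\<lambda>n. D / real n) \<longlonglongrightarrow> 0" by real_asymp
    qed
    then have "cone_converges p (\<lambda>n. Inl (c (real n))) (Inr \<xi>)"
      by (rule cone_converges_sublinear[OF bus proper \<xi>(1)])
    ultimately show ?thesis by (intro cone_limit_in_geo_closure[OF \<xi>(1)])
  qed
  ultimately show "Inl ` horoball \<Phi> y \<union> Inr ` horoball_at_infinity \<Phi> \<subseteq> geo_closure p (horoball \<Phi> y)"
    by blast
qed

lemma horosphere_at_infinity_in_geo_closure:
  fixes p :: "'a::metric_space"
  assumes bus: "busemann_space TYPE('a)" and proper: "proper_space TYPE('a)"
    and complete: "geodesically_complete TYPE('a)" and \<Phi>: "horofunction \<Phi>"
    and "\<xi> \<in> horosphere_at_infinity \<Phi>"
  shows "Inr \<xi> \<in> geo_closure p (horosphere \<Phi> y)"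
proof -
  have \<xi>: "\<xi> \<in> geo_boundary" "Td_le_half_pi \<Phi> \<xi>" "\<not> Td_less_half_pi \<Phi> \<xi>"
    using assms(5) by (auto simp: horosphere_at_infinity_def Td_eq_half_pi_def Td_ge_half_pi_def)
  obtain c where c: "ray c" "c 0 = y" "endpoint c = \<xi>" by (rule ray_in_class[OF bus proper \<xi>(1)])
  note r = geo_path_ray[OF bus proper \<xi>(1), of p]
  obtain D where D: "\<And>t. t \<ge> 0 \<Longrightarrow> dist (c t) (geo_path p (Inr \<xi>) t) \<le> D"
    using rays_same_endpoint_dist_bounded[OF c(1) r(1)] c(3) r(3) by metis
  \<comment> \<open>The hypothesis only says that some ray of the class fails to decrease
    sublinearly. Asymptotic rays change \<Phi> by a bounded amount, so the failure carries over to
    the ray \<open>c\<close> from \<open>y\<close>.\<close>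
  have nd: "\<not> decreases_sublinearly (\<Phi> \<circ> c)"
  proof
    assume "decreases_sublinearly (\<Phi> \<circ> c)"
    then obtain k b where kb: "k < 0" "\<And>t. t \<ge> 0 \<Longrightarrow> \<Phi> (c t) \<le> k * t + b"
      by (auto simp: decreases_sublinearly_def)
    have "decreases_sublinearly (\<Phi> \<circ> c0)" if c0: "ray c0" "endpoint c0 = \<xi>" for c0
    proof -
      obtain E where E: "\<And>t. t \<ge> 0 \<Longrightarrow> dist (c t) (c0 t) \<le> E"
        using rays_same_endpoint_dist_bounded[OF c(1) c0(1)] c(3) c0(2) by metis
      have "\<Phi> (c0 t) \<le> k * t + (b + E)" if "t \<ge> 0" for t
        using kb(2)[OF that] E[OF that] horofunction_Lipschitz[OF \<Phi>, of "c t" "c0 t"] by linarith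
      then show ?thesis using kb(1) by (auto simp: decreases_sublinearly_def)
    qed
    then show False using \<xi>(3) by (simp add: Td_less_half_pi_def)
  qed
  define h where "h n = \<Phi> y - \<Phi> (c (real n))" for n
  have h: "h n \<ge> 0" for n
    using monotone_onD[OF Td_le_half_pi_antimono[OF bus \<Phi> c(1,3) \<xi>(2)], of 0 "real n"] c(2)
    by (simp add: h_def)
  have h0: "(\<lambda>n. h n / real n) \<longlonglongrightarrow> 0"
  proof (rule tendstoI)
    fix e :: real assume "e > 0"
    \<comment> \<open>The slope \<open>e / 2\<close> leaves room for the strict inequality required
      by \<open>tendstoI\<close>.\<close>
    have "\<forall>\<^sub>F t in at_top. (\<Phi> \<circ> c) 0 - (\<Phi> \<circ> c) t \<le> e / 2 * t"
      using horofunction_convex[OF bus \<Phi>, of "{0..}" c] c(1) nd \<open>e > 0\<close>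
      by (intro convex_on_not_decreases_sublinearly) (simp_all add: ray_def del: o_apply)
    then have "\<forall>\<^sub>F n in sequentially. h n \<le> e / 2 * real n"
      using c(2) by (auto simp: h_def dest: eventually_compose_filterlim[OF _ filterlim_real_sequentially])
    then show "\<forall>\<^sub>F n in sequentially. dist (h n / real n) 0 < e"
      using eventually_gt_at_top[of 0]
    proof eventually_elim
      case (elim n)
      have "e / 2 * real n < e * real n" using \<open>e > 0\<close> elim by simp
      then have "h n < e * real n" using elim by linarith
      then show ?case using h[of n] elim by (simp add: field_simps)
    qed
  qed
  have "\<exists>z. dist (c (real n)) z = h n \<and> \<Phi> z = \<Phi> (c (real n)) + h n" for n
    by (rule horofunction_ascent[OF bus proper complete \<Phi> h]) blast
  then obtain z where z: "\<And>n. dist (c (real n)) (z n) = h n"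
      "\<And>n. \<Phi> (z n) = \<Phi> (c (real n)) + h n"
    by metis
  have "z n \<in> horosphere \<Phi> y" for n by (simp add: horosphere_def z(2) h_def)
  moreover have "(\<lambda>n. dist (z n) (geo_path p (Inr \<xi>) (real n)) / real n) \<longlonglongrightarrow> 0"
  proof (rule Lim_null_comparison)
    \<comment> \<open>The gap consists of the climb \<open>h n = o(n)\<close> back to the horosphere
      and the change \<open>D\<close> of base point.\<close>
    have "dist (z n) (geo_path p (Inr \<xi>) (real n)) \<le> h n + D" for n
      using dist_triangle[of "z n" "geo_path p (Inr \<xi>) (real n)" "c (real n)"] D[of "real n"] z(1)[of n]
      by (simp add: dist_commute del: geo_path.simps)
    then show "\<forall>\<^sub>F n in sequentially.
        norm (dist (z n) (geo_path p (Inr \<xi>) (real n)) / real n) \<le> h n / real n + D / real n"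
      by (intro always_eventually)
        (simp add: divide_right_mono del: geo_path.simps flip: add_divide_distrib)
    have "(\<lambda>n. D / real n) \<longlonglongrightarrow> 0" by real_asymp
    with h0 show "(\<lambda>n. h n / real n + D / real n) \<longlonglongrightarrow> 0" using tendsto_add by fastforce
  qed
  then have "cone_converges p (\<lambda>n. Inl (z n)) (Inr \<xi>)"
    by (rule cone_converges_sublinear[OF bus proper \<xi>(1)])
  ultimately show ?thesis by (intro cone_limit_in_geo_closure[OF \<xi>(1)])
qed

theorem lemma5p1:
  fixes p :: "'a::metric_space"
  assumes "busemann_space TYPE('a)" and "proper_space TYPE('a)"
  shows "(\<forall>(\<Phi> :: 'a \<Rightarrow> real) y. horofunction \<Phi> \<longrightarrow>
            geo_closure p (horoball \<Phi> y) = Inl ` horoball \<Phi> y \<union> Inr ` horoball_at_infinity \<Phi>)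
       \<and> (geodesically_complete TYPE('a) \<longrightarrow>
            (\<forall>(\<Phi> :: 'a \<Rightarrow> real) y. horofunction \<Phi> \<longrightarrow>
               Inr ` horosphere_at_infinity \<Phi>
                 \<subseteq> geo_closure p (horosphere \<Phi> y) - Inl ` horosphere \<Phi> y))"
  \<comment> \<open>Boundary points are tagged \<open>Inr\<close>, so removing the
    \<open>Inl\<close> image of the horosphere leaves them in place.\<close>
  using geo_closure_horoball[OF assms] horosphere_at_infinity_in_geo_closure[OF assms] by blast

end
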